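(* Let $M \ge 1$ be an integer and let $C \in \mathbb{R}^{M\times M}$ be a circulant matrix. Then all eigenvalues of $C$ are real if and only if $C$ is a symmetric circulant matrix.
   Context: A matrix $C \in \mathbb{C}^{M\times M}$ is circulant with first row $(c_0, c_1, \dots, c_{M-1})$ if each row is the cyclic shift by one position to the right of the previous row; that is, $C_{ij} = c_{(j-i) \bmod M}$. A circulant matrix with first row $(c_0, c_1, \dots, c_{M-1})$ is called a symmetric circulant if $c_m = c_{M-m}$ for all $1 \le m \le M-1$. *)

theory Defs
  imports Complex_Main "Jordan_Normal_Form.Char_Poly"
begin

(* The matrix index is taken in int, because j - i is truncated on nat. *)
definition circulant_mat :: "'a vec \<Rightarrow> 'a mat" where
  "circulant_mat c = mat (dim_vec c) (dim_vec c)
     (\<lambda>(i, j). c $ nat ((int j - int i) mod int (dim_vec c)))"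

definition circulant :: "nat \<Rightarrow> 'a mat \<Rightarrow> bool" where
  "circulant M C \<longleftrightarrow> (\<exists>c \<in> carrier_vec M. C = circulant_mat c)"

definition symmetric_circulant :: "nat \<Rightarrow> 'a mat \<Rightarrow> bool" where
  "symmetric_circulant M C \<longleftrightarrow>
     (\<exists>c \<in> carrier_vec M. C = circulant_mat c \<and> (\<forall>m. 1 \<le> m \<and> m \<le> M - 1 \<longrightarrow> c $ m = c $ (M - m)))"

end

theory Submission
  imports Defs
begin

text \<open>
  The complex eigenvectors of a circulant matrix are the geometric progressions
  \<open>(1, z, z\<^sup>2, \<dots>)\<close> of the \<open>M\<close>-th roots of unity \<open>z\<close>, and the eigenvalue belonging to \<open>z\<close> is the
  value at \<open>z\<close> of the polynomial whose coefficients form the first row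
  (\<open>eigenvalue_circulant_mat\<close>).  Conjugating a root of unity inverts it, so for a real first row the
  complex conjugate of this value is the value at \<open>z\<close> of the polynomial with the coefficients
  reflected by \<open>m \<mapsto> -m\<close> modulo \<open>M\<close> (\<open>cnj_sum_root_of_unity\<close>).  If all eigenvalues are real, then
  these two polynomials of degree below \<open>M\<close> agree at all \<open>M\<close> roots of unity, hence they coincide
  (\<open>coeffs_eq_if_eq_on_roots_of_unity\<close>), which is the symmetry of the first row.

  Conversely, symmetry of the first row makes the whole matrix symmetric, and a real symmetric
  matrix has only real eigenvalues because its quadratic form \<open>v \<mapsto> v\<^sup>* A v\<close> takes real values
  (\<open>eigenvalue_real_symmetric_in_Reals\<close>).
\<close>

section \<open>Roots of unity and reflected sums\<close>

lemma power_nat_mod_root_of_unity: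
  fixes z :: "'a::field"
  assumes "z ^ M = 1" and "M \<ge> 1"
  shows "z ^ i * z ^ nat ((int j - int i) mod int M) = z ^ j"
proof -
  define m where "m = nat ((int j - int i) mod int M)"
  have red: "z ^ n = z ^ (n mod M)" for n
    by (metis assms(1) mod_div_mult_eq mult.commute mult.right_neutral power_add power_mult power_one)
  have "int (i + m) mod int M = int j mod int M"
    using assms(2) by (simp add: m_def mod_simps)
  hence "(i + m) mod M = j mod M"
    by (metis of_nat_eq_iff of_nat_mod)
  thus ?thesis
    by (metis m_def power_add red)
qed

lemma sum_cyclic_shift:
  fixes f :: "nat \<Rightarrow> 'a::comm_monoid_add"
  assumes "i < M"
  shows "(\<Sum>j<M. f (nat ((int j - int i) mod int M))) = (\<Sum>m<M. f m)"
proof (rule sum.reindex_bij_witness[where i = "\<lambda>m. (m + i) mod M"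
      and j = "\<lambda>j. nat ((int j - int i) mod int M)"])
  fix j assume "j \<in> {..<M}"
  have "int ((nat ((int j - int i) mod int M) + i) mod M) = int j"
    using assms \<open>j \<in> {..<M}\<close> by (simp add: zmod_int mod_simps)
  thus "(nat ((int j - int i) mod int M) + i) mod M = j" by linarith
next
  fix m assume "m \<in> {..<M}"
  thus "nat ((int ((m + i) mod M) - int i) mod int M) = m"
    by (simp add: zmod_int mod_simps)
qed (use assms in \<open>auto simp: nat_less_iff\<close>)

text \<open>
  Here \<open>cnj z = 1 / z\<close>, so conjugation turns \<open>z ^ m\<close> into \<open>z ^ (M - m)\<close>.  The outer \<open>mod M\<close> on the
  reflected index keeps \<open>m = 0\<close> fixed.
\<close>

lemma cnj_sum_root_of_unity:
  fixes c :: "nat \<Rightarrow> real" and z :: complex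
  assumes z: "z ^ M = 1" and M: "M \<ge> 1"
  shows "cnj (\<Sum>m<M. of_real (c m) * z ^ m) = (\<Sum>m<M. of_real (c ((M - m) mod M)) * z ^ m)"
proof -
  have "norm z = 1"
    using z M by (metis norm_one norm_power norm_ge_zero power_eq_1_iff not_one_le_zero)
  hence zc: "z * cnj z = 1"
    by (simp add: complex_norm_square[symmetric])
  have conj_pow: "cnj z ^ ((M - m) mod M) = z ^ m" if "m < M" for m
  proof (cases "m = 0")
    case False
    have "z ^ m * (cnj z ^ m * cnj z ^ (M - m)) = z ^ m"
      using that z by (metis complex_cnj_one complex_cnj_power le_add_diff_inverse
          less_imp_le_nat mult.right_neutral power_add)
    moreover have "z ^ m * cnj z ^ m = 1"
      by (metis zc power_mult_distrib power_one)
    ultimately show ?thesis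
      using that False by (simp add: mult.assoc[symmetric])
  qed simp
  have reflect: "(M - (M - m) mod M) mod M = m" if "m < M" for m
    using that by (cases "m = 0") auto
  have "cnj (\<Sum>m<M. of_real (c m) * z ^ m) = (\<Sum>m<M. of_real (c m) * cnj z ^ m)"
    by simp
  also have "\<dots> = (\<Sum>m<M. of_real (c ((M - m) mod M)) * z ^ m)"
  proof (rule sum.reindex_bij_witness[where i = "\<lambda>m. (M - m) mod M" and j = "\<lambda>m. (M - m) mod M"])
    fix m assume m: "m \<in> {..<M}"
    show "complex_of_real (c ((M - (M - m) mod M) mod M)) * z ^ ((M - m) mod M)
        = of_real (c m) * cnj z ^ m"
      using conj_pow[of "(M - m) mod M"] m M by (simp add: reflect)
  qed (use M in \<open>auto simp: reflect\<close>)
  finally show ?thesis .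
qed

text \<open>
  The two sums are values of polynomials of degree below \<open>M\<close>, and there are \<open>M\<close> complex \<open>M\<close>-th roots
  of unity, which is enough points to make the polynomials equal.
\<close>

lemma coeffs_eq_if_eq_on_roots_of_unity:
  fixes f g :: "nat \<Rightarrow> complex"
  assumes M: "M \<ge> 1" and m: "m < M"
    and eq: "\<And>z. z ^ M = 1 \<Longrightarrow> (\<Sum>m<M. f m * z ^ m) = (\<Sum>m<M. g m * z ^ m)"
  shows "f m = g m"
proof -
  define p where "p h = (\<Sum>m<M. monom (h m) m)" for h :: "nat \<Rightarrow> complex"
  have coeff: "coeff (p h) n = (if n < M then h n else 0)" for h n
    by (simp add: p_def coeff_sum if_distrib sum.If_cases)
  have deg: "degree (p h) < M" for h
  proof -
    have "degree (p h) \<le> M - 1"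
      using M by (intro degree_le) (auto simp: coeff)
    thus ?thesis using M by simp
  qed
  have card: "card {z::complex. z ^ M = 1} = M"
    using M by (intro card_roots_unity_eq) auto
  have "p f = p g"
  proof (rule poly_eqI_degree[where A = "{z. z ^ M = 1}"])
    fix z :: complex assume "z \<in> {z. z ^ M = 1}"
    thus "poly (p f) z = poly (p g) z"
      using eq[of z] by (simp add: p_def poly_sum poly_monom)
  qed (simp_all add: card deg)
  thus ?thesis
    using m by (metis coeff)
qed

section \<open>Eigenvalues\<close>

text \<open>
  The eigenvector is \<open>(z\<^sup>j)\<^sub>j\<close>: since \<open>z\<close> has period \<open>M\<close>, the cyclic shift by \<open>i\<close> of the first row
  in row \<open>i\<close> only contributes the factor \<open>z\<^sup>i\<close>.
\<close>

lemma eigenvalue_circulant_mat: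
  fixes z :: complex and c :: "real vec"
  assumes z: "z ^ M = 1" and M: "M \<ge> 1" and c: "c \<in> carrier_vec M"
  shows "eigenvalue (map_mat complex_of_real (circulant_mat c)) (\<Sum>m<M. of_real (c $ m) * z ^ m)"
    (is "eigenvalue ?A ?k")
proof -
  define v where "v = vec M (\<lambda>j. z ^ j)"
  have dim: "dim_vec c = M" using c by simp
  have A: "?A \<in> carrier_mat M M"
    by (simp add: circulant_mat_def dim)
  have "?A *\<^sub>v v = ?k \<cdot>\<^sub>v v"
  proof (rule eq_vecI)
    fix i assume "i < dim_vec (?k \<cdot>\<^sub>v v)"
    hence i: "i < M" by (simp add: v_def)
    define s where "s j = nat ((int j - int i) mod int M)" for j
    have "(?A *\<^sub>v v) $ i = (\<Sum>j<M. of_real (c $ s j) * z ^ j)"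
      using i by (simp add: v_def circulant_mat_def dim scalar_prod_def s_def lessThan_atLeast0)
    also have "\<dots> = (\<Sum>j<M. z ^ i * (of_real (c $ s j) * z ^ s j))"
      unfolding s_def
      by (intro sum.cong refl) (metis power_nat_mod_root_of_unity[OF z M] mult.left_commute)
    also have "\<dots> = z ^ i * ?k"
      unfolding s_def sum_distrib_left[symmetric]
      by (subst sum_cyclic_shift[OF i, of "\<lambda>m. of_real (c $ m) * z ^ m"]) simp
    finally show "(?A *\<^sub>v v) $ i = (?k \<cdot>\<^sub>v v) $ i"
      using i by (simp add: v_def mult.commute)
  qed (simp add: v_def circulant_mat_def dim)
  moreover have "v \<noteq> 0\<^sub>v M"
  proof
    assume "v = 0\<^sub>v M"
    hence "v $ 0 = 0\<^sub>v M $ 0" by simp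
    thus False using M by (simp add: v_def)
  qed
  moreover have "v \<in> carrier_vec M" by (simp add: v_def)
  ultimately show ?thesis
    using A unfolding eigenvalue_def eigenvector_def by auto
qed

text \<open>
  For an eigenvector \<open>v\<close> the number \<open>q = v\<^sup>* A v\<close> equals its own conjugate by symmetry of \<open>A\<close>, and it
  is the eigenvalue times the positive real number \<open>v\<^sup>* v\<close>.
\<close>

lemma eigenvalue_real_symmetric_in_Reals:
  fixes A :: "real mat"
  assumes A: "A \<in> carrier_mat n n"
    and sym: "\<And>i j. i < n \<Longrightarrow> j < n \<Longrightarrow> A $$ (i, j) = A $$ (j, i)"
    and ev: "eigenvalue (map_mat complex_of_real A) k"
  shows "k \<in> \<real>"
proof -
  obtain v where v: "v \<in> carrier_vec n" "v \<noteq> 0\<^sub>v n"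
    and Av: "map_mat complex_of_real A *\<^sub>v v = k \<cdot>\<^sub>v v"
    using ev A unfolding eigenvalue_def eigenvector_def by auto
  have row: "(\<Sum>j<n. of_real (A $$ (i, j)) * v $ j) = k * v $ i" if i: "i < n" for i
  proof -
    have "(map_mat complex_of_real A *\<^sub>v v) $ i = (k \<cdot>\<^sub>v v) $ i"
      by (simp only: Av)
    thus ?thesis
      using i v A by (simp add: scalar_prod_def lessThan_atLeast0)
  qed
  define q where "q = (\<Sum>i<n. \<Sum>j<n. cnj (v $ i) * of_real (A $$ (i, j)) * v $ j)"
  define s where "s = (\<Sum>i<n. (cmod (v $ i))\<^sup>2)"
  have "q = (\<Sum>i<n. cnj (v $ i) * (k * v $ i))"
    unfolding q_def by (intro sum.cong refl) (simp add: row[symmetric] sum_distrib_left mult.assoc)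
  also have "\<dots> = k * of_real s"
    by (simp add: s_def sum_distrib_left mult_ac complex_norm_square del: of_real_power)
  finally have qs: "q = k * of_real s" .
  have "cnj q = (\<Sum>i<n. \<Sum>j<n. v $ i * of_real (A $$ (i, j)) * cnj (v $ j))"
    by (simp add: q_def)
  also have "\<dots> = (\<Sum>j<n. \<Sum>i<n. v $ i * of_real (A $$ (i, j)) * cnj (v $ j))"
    by (rule sum.swap)
  also have "\<dots> = q"
    unfolding q_def by (intro sum.cong refl) (simp add: sym mult_ac)
  finally have "q \<in> \<real>"
    by (simp add: Reals_cnj_iff)
  obtain i where i: "i < n" "v $ i \<noteq> 0"
    using v by (metis carrier_vecD eq_vecI index_zero_vec)
  have "s > 0"
    unfolding s_def using i by (intro sum_pos2[of _ i]) auto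
  hence "k = q / of_real s" by (simp add: qs)
  thus ?thesis
    using \<open>q \<in> \<real>\<close> by simp
qed

section \<open>Symmetric circulant matrices\<close>

lemma symmetric_circulant_mat_entries:
  assumes c: "c \<in> carrier_vec M"
    and sym: "\<And>m. 1 \<le> m \<Longrightarrow> m \<le> M - 1 \<Longrightarrow> c $ m = c $ (M - m)"
    and i: "i < M" and j: "j < M"
  shows "circulant_mat c $$ (i, j) = circulant_mat c $$ (j, i)"
proof -
  define m where "m = nat ((int j - int i) mod int M)"
  have m: "m < M" using i by (simp add: m_def nat_less_iff)
  have "int m = (int j - int i) mod int M"
    using i by (simp add: m_def)
  moreover have "(int i - int j) mod int M
      = (if (int j - int i) mod int M = 0 then 0 else int M - (int j - int i) mod int M)"
    using zmod_zminus1_eq_if[of "int j - int i" "int M"] by simp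
  ultimately have refl: "nat ((int i - int j) mod int M) = (if m = 0 then 0 else M - m)"
    using m by (auto simp: nat_diff_distrib)
  have "c $ m = c $ nat ((int i - int j) mod int M)"
    using sym[of m] m by (auto simp: refl)
  thus ?thesis
    using c i j by (simp add: circulant_mat_def m_def)
qed

theorem theorem1:
  fixes M :: nat and C :: "real mat"
  assumes "M \<ge> 1"
    and "C \<in> carrier_mat M M"
    and "circulant M C"
  shows "(\<forall>k. eigenvalue (map_mat complex_of_real C) k \<longrightarrow> k \<in> \<real>) \<longleftrightarrow> symmetric_circulant M C"
proof
  assume real: "\<forall>k. eigenvalue (map_mat complex_of_real C) k \<longrightarrow> k \<in> \<real>"
  obtain c where c: "c \<in> carrier_vec M" and C: "C = circulant_mat c"
    using assms(3) by (auto simp: circulant_def)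
  have eq: "(\<Sum>m<M. complex_of_real (c $ m) * z ^ m)
      = (\<Sum>m<M. of_real (c $ ((M - m) mod M)) * z ^ m)" if "z ^ M = 1" for z
  proof -
    have "(\<Sum>m<M. complex_of_real (c $ m) * z ^ m) \<in> \<real>"
      using real eigenvalue_circulant_mat[OF that assms(1) c] C by blast
    thus ?thesis
      using cnj_sum_root_of_unity[OF that assms(1), of "\<lambda>m. c $ m"] by (metis Reals_cnj_iff)
  qed
  have "c $ m = c $ (M - m)" if "1 \<le> m" "m \<le> M - 1" for m
  proof -
    have "complex_of_real (c $ m) = of_real (c $ ((M - m) mod M))"
      using that by (intro coeffs_eq_if_eq_on_roots_of_unity[OF assms(1) _ eq]) auto
    thus ?thesis using that by simp
  qed
  thus "symmetric_circulant M C"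
    unfolding symmetric_circulant_def using c C by blast
next
  assume "symmetric_circulant M C"
  then obtain c where c: "c \<in> carrier_vec M" and C: "C = circulant_mat c"
    and sym: "\<And>m. 1 \<le> m \<Longrightarrow> m \<le> M - 1 \<Longrightarrow> c $ m = c $ (M - m)"
    unfolding symmetric_circulant_def by blast
  have "C $$ (i, j) = C $$ (j, i)" if "i < M" "j < M" for i j
    unfolding C using c sym that by (rule symmetric_circulant_mat_entries)
  thus "\<forall>k. eigenvalue (map_mat complex_of_real C) k \<longrightarrow> k \<in> \<real>"
    using eigenvalue_real_symmetric_in_Reals[OF assms(2)] by blast
qed

end
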